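(* Let $\mathcal H$ be a real Hilbert space and let $A:\mathcal H\to 2^{\mathcal H}$ be a maximally monotone operator with $S=A^{-1}(0)\ne\emptyset$. Suppose there is $\nu>0$ such that, for all $x\in\mathcal H$, all $x^*\in Ax$ and all $z\in S$, $$\langle x^*,x-z\rangle\ge\nu\,\mathrm{dist}(x,S)^2.$$ Let $s>0$, $\alpha>2$ and $\lambda_k=(1+\epsilon)\frac{sk^2}{\alpha^2}$ ($k\ge1$) with $\epsilon>\frac{2}{\alpha-2}$. Let $(x_k)$ be a sequence generated, from arbitrary $x_0,x_1\in\mathcal H$, by the algorithm: for all $k\ge1$, $$\left\{\begin{array}{rcl} y_k&=&x_k+\left(1-\frac{\alpha}{k}\right)(x_k-x_{k-1}),\\ x_{k+1}&=&\frac{\lambda_k}{\lambda_k+s}\,y_k+\frac{s}{\lambda_k+s}\left(I+(\lambda_k+s)A\right)^{-1}(y_k).\end{array}\right.$$ Then $\lim_{k\to+\infty}\mathrm{dist}(x_k,S)=0$. If, moreover, $S=\{\bar z\}$, then $x_k$ converges strongly to $\bar z$ as $k\to+\infty$.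
   Context: $S=A^{-1}(0)=\{z\in\mathcal H:0\in Az\}$ and $\mathrm{dist}(x,S)=\inf_{z\in S}\|x-z\|$. For $\mu>0$, $(I+\mu A)^{-1}$ denotes the resolvent of $A$ with index $\mu$ (single-valued and everywhere defined since $A$ is maximally monotone). *)

theory Defs
  imports "HOL-Analysis.Analysis"
begin

text \<open>A set-valued operator on the space is a function into subsets; its graph is the set of
  pairs \<open>(x, u)\<close> with \<open>u \<in> A x\<close>.\<close>

definition monotone_operator :: "('a::real_inner \<Rightarrow> 'a set) \<Rightarrow> bool" where
  "monotone_operator A \<longleftrightarrow>
     (\<forall>x y. \<forall>u\<in>A x. \<forall>v\<in>A y. inner (u - v) (x - y) \<ge> 0)"

definition maximally_monotone :: "('a::real_inner \<Rightarrow> 'a set) \<Rightarrow> bool" where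
  "maximally_monotone A \<longleftrightarrow>
     monotone_operator A \<and>
     (\<forall>B. monotone_operator B \<and> (\<forall>x. A x \<subseteq> B x) \<longrightarrow> B = A)"

definition inverse_operator :: "('a \<Rightarrow> 'a set) \<Rightarrow> 'a \<Rightarrow> 'a set" where
  "inverse_operator A y = {x. y \<in> A x}"

definition id_plus_operator :: "real \<Rightarrow> ('a::real_vector \<Rightarrow> 'a set) \<Rightarrow> 'a \<Rightarrow> 'a set" where
  "id_plus_operator \<mu> A x = {x + \<mu> *\<^sub>R u | u. u \<in> A x}"

text \<open>The resolvent as a point-valued map. The description is meaningful for \<open>\<mu> > 0\<close> and a
  maximally monotone \<open>A\<close> on a Hilbert space, where by Minty's theorem the set-valued operator
  \<open>(I + \<mu> A)\<inverse>\<close> takes exactly one value at every point.\<close>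

definition resolvent :: "('a::real_vector \<Rightarrow> 'a set) \<Rightarrow> real \<Rightarrow> 'a \<Rightarrow> 'a" where
  "resolvent A \<mu> y = (THE p. p \<in> inverse_operator (id_plus_operator \<mu> A) y)"

end

theory Submission
  imports Defs
begin

text \<open>Write \<open>d\<^sub>k = x\<^sub>k - x\<^sub>k\<^sub>-\<^sub>1\<close>, let \<open>p\<^sub>k\<close> be the resolvent of \<open>A\<close> with index \<open>\<lambda>\<^sub>k + s\<close> at \<open>y\<^sub>k\<close>, and put
  \<open>\<xi>\<^sub>k = (y\<^sub>k - p\<^sub>k) / (\<lambda>\<^sub>k + s)\<close>. By Minty's theorem \<open>p\<^sub>k\<close> exists (\<open>resolvent_inclusion\<close>), so
  \<open>\<xi>\<^sub>k \<in> A p\<^sub>k\<close>, and one step of the algorithm has the two readings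
  \<open>x\<^sub>k\<^sub>+\<^sub>1 = y\<^sub>k - s \<xi>\<^sub>k = p\<^sub>k + \<lambda>\<^sub>k \<xi>\<^sub>k\<close>: it is an explicit step along \<open>\<xi>\<^sub>k\<close>, and it lands at a distance
  \<open>\<lambda>\<^sub>k \<parallel>\<xi>\<^sub>k\<parallel>\<close> from a point where the growth condition can be used.

  For a fixed \<open>z \<in> S\<close>, combining both readings bounds \<open>s \<langle>\<xi>\<^sub>k, p\<^sub>k - z\<rangle>\<close> by a difference of anchor
  terms \<open>\<parallel>x\<^sub>k - z\<parallel>\<^sup>2\<close> and velocity terms. Since \<open>\<lambda>\<^sub>k\<close> grows like \<open>k\<^sup>2\<close>, multiplying by \<open>k\<close> makes
  everything telescope into an energy that is nonnegative (\<open>energy_nonneg\<close>) and eventually decreases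
  (\<open>energy_step\<close>); the condition \<open>\<epsilon> > 2 / (\<alpha> - 2)\<close> is exactly positivity of the coefficient of
  \<open>k \<parallel>d\<^sub>k\<parallel>\<^sup>2\<close> in the decrease. Hence \<open>k \<parallel>d\<^sub>k\<parallel>\<^sup>2\<close>, \<open>k\<^sup>3 \<parallel>d\<^sub>k\<^sub>+\<^sub>1 - d\<^sub>k\<parallel>\<^sup>2\<close> and \<open>k dist(p\<^sub>k, S)\<^sup>2\<close> are all
  summable.

  The first two sums control \<open>\<lambda>\<^sub>k \<xi>\<^sub>k\<close>, a combination of \<open>k\<^sup>2 (d\<^sub>k\<^sub>+\<^sub>1 - d\<^sub>k)\<close> and \<open>k d\<^sub>k\<close>, so that with the
  third one \<open>dist(x\<^sub>k\<^sub>+\<^sub>1, S)\<^sup>2 / k\<close> is summable. As the distance function is nonexpansive, the first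
  sum also bounds the increments of \<open>dist(x\<^sub>k, S)\<close>. A sequence whose squares are summable with
  weight \<open>1 / k\<close> and whose squared increments are summable with weight \<open>k\<close> tends to zero
  (\<open>tendsto_zero_of_weighted_summable\<close>): its square converges because the increments of the
  square are absolutely summable, and divergence of the harmonic series excludes a positive limit.\<close>

section \<open>Surjectivity of the resolvent equation\<close>

text \<open>The functional \<open>\<parallel>w\<parallel>\<^sup>2 / 2 + t\<close> is minimised over \<open>E\<close>. It is strongly convex in \<open>w\<close>, so
  minimising sequences converge in norm by the parallelogram law. The inequality is the
  first-order optimality condition: if \<open>E\<close> is the epigraph of a convex function, it says that \<open>- w\<close> is a subgradient of that function at \<open>w\<close>.\<close>

lemma prox_point_exists:
  fixes E :: "('b::{real_inner, complete_space} \<times> real) set"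
  assumes "closed E" and "convex E" and "E \<noteq> {}"
    and below: "\<And>w t. (w, t) \<in> E \<Longrightarrow> b \<le> (norm w)\<^sup>2 / 2 + t"
  shows "\<exists>w t. (w, t) \<in> E \<and> (\<forall>w' t'. (w', t') \<in> E \<longrightarrow> t - inner w (w' - w) \<le> t')"
proof -
  define J :: "'b \<times> real \<Rightarrow> real" where "J = (\<lambda>e. (norm (fst e))\<^sup>2 / 2 + snd e)"
  define m where "m = Inf (J ` E)"
  have bdd: "bdd_below (J ` E)"
    using below by (intro bdd_belowI2[where m = b]) (auto simp: J_def)
  have m_le: "m \<le> J e" if "e \<in> E" for e
    unfolding m_def using bdd that by (intro cInf_lower) auto
  have "\<exists>e\<in>E. J e < m + 1 / real (Suc n)" for n
  proof -
    have "Inf (J ` E) < m + 1 / real (Suc n)" by (simp add: m_def)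
    then show ?thesis using cInf_lessD[of "J ` E"] \<open>E \<noteq> {}\<close> by blast
  qed
  then obtain e where eE: "e n \<in> E" and eJ: "J (e n) < m + 1 / real (Suc n)" for n
    by metis
  have gap: "(norm (fst a - fst c))\<^sup>2 \<le> 4 * (J a - m) + 4 * (J c - m)" if "a \<in> E" "c \<in> E" for a c
  proof -
    \<comment> \<open>Parallelogram law, with the midpoint as competitor for the minimum.\<close>
    have "(1/2) *\<^sub>R a + (1/2) *\<^sub>R c \<in> E"
      using \<open>convex E\<close> that by (simp add: convex_def)
    then have "m \<le> J ((1/2) *\<^sub>R a + (1/2) *\<^sub>R c)" by (rule m_le)
    also have "\<dots> = (J a + J c) / 2 - (norm (fst a - fst c))\<^sup>2 / 8"
      by (simp add: J_def power2_norm_eq_inner inner_add_left inner_add_right inner_diff_left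
          inner_diff_right inner_commute field_simps)
    finally show ?thesis by (simp add: field_simps)
  qed
  have "Cauchy (\<lambda>n. fst (e n))"
  proof (rule CauchyI)
    fix r :: real assume "r > 0"
    then obtain N where N: "1 / real (Suc N) < r\<^sup>2 / 8"
      using reals_Archimedean[of "r\<^sup>2 / 8"] by (auto simp: inverse_eq_divide)
    have small: "8 * (J (e n) - m) < r\<^sup>2" if "n \<ge> N" for n
    proof -
      have "1 / real (Suc n) \<le> 1 / real (Suc N)" using that by (simp add: frac_le)
      then have "J (e n) - m < r\<^sup>2 / 8" using eJ[of n] N by linarith
      then show ?thesis by simp
    qed
    have "norm (fst (e i) - fst (e j)) < r" if "i \<ge> N" "j \<ge> N" for i j
    proof -
      have "(norm (fst (e i) - fst (e j)))\<^sup>2 < r\<^sup>2"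
        using gap[OF eE eE, of i j] small[OF that(1)] small[OF that(2)] by linarith
      then show ?thesis using \<open>r > 0\<close> by (simp add: power_less_imp_less_base)
    qed
    then show "\<exists>M. \<forall>i\<ge>M. \<forall>j\<ge>M. norm (fst (e i) - fst (e j)) < r" by blast
  qed
  then obtain w where w: "(\<lambda>n. fst (e n)) \<longlonglongrightarrow> w"
    using Cauchy_convergent convergent_def by blast
  define t where "t = m - (norm w)\<^sup>2 / 2"
  have Jlim: "(\<lambda>n. J (e n)) \<longlonglongrightarrow> m"
  proof (rule tendsto_sandwich)
    show "\<forall>\<^sub>F n in sequentially. m \<le> J (e n)"
      using m_le eE by (intro always_eventually) auto
    show "\<forall>\<^sub>F n in sequentially. J (e n) \<le> m + 1 / real (Suc n)"
      using eJ by (intro always_eventually) (auto intro: less_imp_le)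
    show "(\<lambda>n. m + 1 / real (Suc n)) \<longlonglongrightarrow> m"
      using tendsto_add[OF tendsto_const LIMSEQ_inverse_real_of_nat, of m]
      by (simp add: inverse_eq_divide)
  qed auto
  have "(\<lambda>n. J (e n) - (norm (fst (e n)))\<^sup>2 / 2) \<longlonglongrightarrow> t"
    unfolding t_def by (intro tendsto_intros Jlim w) auto
  then have "(\<lambda>n. snd (e n)) \<longlonglongrightarrow> t" by (simp add: J_def)
  then have "(\<lambda>n. (fst (e n), snd (e n))) \<longlonglongrightarrow> (w, t)" by (intro tendsto_Pair w)
  then have "e \<longlonglongrightarrow> (w, t)" by simp
  then have wtE: "(w, t) \<in> E" using \<open>closed E\<close> eE closed_sequentially by blast
  show ?thesis
  proof (intro exI conjI allI impI)
    show "(w, t) \<in> E" by (rule wtE)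
    fix w' t' assume E': "(w', t') \<in> E"
    \<comment> \<open>\<open>q\<close> is the directional derivative of \<open>J\<close> at the minimiser towards \<open>(w', t')\<close>.\<close>
    define q where "q = inner w (w' - w) + (t' - t)"
    have q_ge: "q \<ge> - (l * (norm (w' - w))\<^sup>2 / 2)" if "0 < l" "l \<le> 1" for l :: real
    proof -
      have "(1 - l) *\<^sub>R (w, t) + l *\<^sub>R (w', t') \<in> E"
        using that by (intro convexD[OF \<open>convex E\<close> wtE E']) auto
      then have "m \<le> J ((1 - l) *\<^sub>R (w, t) + l *\<^sub>R (w', t'))" by (rule m_le)
      also have "(1 - l) *\<^sub>R (w, t) + l *\<^sub>R (w', t') = (w + l *\<^sub>R (w' - w), t + l * (t' - t))"
        by (simp add: algebra_simps)
      also have "J \<dots> = m + l * (q + l * (norm (w' - w))\<^sup>2 / 2)"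
        by (simp add: J_def t_def q_def power2_norm_eq_inner inner_add_left inner_add_right
          inner_diff_left inner_diff_right inner_commute field_simps)
      finally have "0 \<le> l * (q + l * (norm (w' - w))\<^sup>2 / 2)" by simp
      then show ?thesis using that by (simp add: zero_le_mult_iff)
    qed
    have "((\<lambda>l. - (l * (norm (w' - w))\<^sup>2 / 2)) \<longlongrightarrow> - (0 * (norm (w' - w))\<^sup>2 / 2)) (at_right 0)"
      by (intro tendsto_intros) auto
    moreover have "\<forall>\<^sub>F l in at_right (0::real). - (l * (norm (w' - w))\<^sup>2 / 2) \<le> q"
      unfolding eventually_at_right_field using q_ge by (intro exI[of _ 1]) auto
    ultimately have "0 \<le> q"
      by (intro tendsto_upperbound[of _ 0 "at_right 0"]) auto
    then show "t - inner w (w' - w) \<le> t'" by (simp add: q_def)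
  qed
qed

text \<open>Minty's theorem by way of the Fitzpatrick function
  \<open>F(a, b) = sup {\<langle>a, u\<rangle> + \<langle>b, v\<rangle> - \<langle>u, v\<rangle> | (v, u) \<in> G}\<close>, whose epigraph is the set \<open>E\<close> of the
  proof; working with the epigraph avoids infinite values. Monotonicity gives
  \<open>F(v, u) \<le> \<langle>v, u\<rangle>\<close> on \<open>G\<close>, maximality gives \<open>F(a, b) \<ge> \<langle>a, b\<rangle>\<close> everywhere. The optimality
  condition at a minimiser \<open>(a, b)\<close> of \<open>\<parallel>(a, b)\<parallel>\<^sup>2 / 2 + F(a, b)\<close> then says that \<open>(- b, - a)\<close> is
  monotonically related to \<open>G\<close> with the surplus \<open>\<parallel>a + b\<parallel>\<^sup>2\<close>. By maximality this point lies in \<open>G\<close>,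
  and testing it against itself forces \<open>a = - b\<close>.\<close>

lemma minty_graph:
  fixes G :: "('a::{real_inner, complete_space} \<times> 'a) set"
  assumes mono: "\<And>v u v' u'. (v, u) \<in> G \<Longrightarrow> (v', u') \<in> G \<Longrightarrow> 0 \<le> inner (u - u') (v - v')"
    and maximal: "\<And>v u. (\<And>v' u'. (v', u') \<in> G \<Longrightarrow> 0 \<le> inner (u - u') (v - v')) \<Longrightarrow> (v, u) \<in> G"
  obtains p where "(p, - p) \<in> G"
proof -
  define E :: "(('a \<times> 'a) \<times> real) set" where
    "E = (\<Inter>(v, u)\<in>G. {((a, b), t). inner a u + inner b v - inner u v \<le> t})"
  have E_iff: "((a, b), t) \<in> E \<longleftrightarrow> (\<forall>(v, u)\<in>G. inner a u + inner b v - inner u v \<le> t)" for a b t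
    by (auto simp: E_def)
  have halfspace: "{((a, b), t). inner a u + inner b v - inner u v \<le> t}
      = {e. inner ((u, v), - 1 :: real) e \<le> inner u v}" for u v :: 'a
    by (auto simp: inner_commute)
  have "closed E"
    unfolding E_def by (intro closed_INT) (auto simp: halfspace closed_halfspace_le)
  have "convex E"
    unfolding E_def by (intro convex_INT) (auto simp: halfspace convex_halfspace_le)
  have on_graph: "((v, u), inner v u) \<in> E" if "(v, u) \<in> G" for v u
  proof -
    have "inner v u' + inner u v' - inner u' v' \<le> inner v u" if "(v', u') \<in> G" for v' u'
      using mono[OF \<open>(v, u) \<in> G\<close> that]
      by (simp add: inner_diff_left inner_diff_right inner_commute)
    then show ?thesis by (auto simp: E_iff)
  qed
  have "G \<noteq> {}" using maximal by blast
  then have "E \<noteq> {}" using on_graph by fastforce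
  have above: "inner a b \<le> t" if "((a, b), t) \<in> E" for a b t
  proof (cases "(a, b) \<in> G")
    case True
    then show ?thesis using that by (force simp: E_iff inner_commute)
  next
    case False
    then obtain v u where "(v, u) \<in> G" and "inner (b - u) (a - v) < 0"
      using maximal[where v = a and u = b] by force
    moreover from this have "inner a u + inner b v - inner u v \<le> t"
      using that by (auto simp: E_iff)
    ultimately show ?thesis by (simp add: inner_diff_left inner_diff_right inner_commute)
  qed
  have "0 \<le> (norm w)\<^sup>2 / 2 + t" if "(w, t) \<in> E" for w t
  proof -
    obtain a b where w: "w = (a, b)" by fastforce
    have "0 \<le> (norm (a + b))\<^sup>2 / 2" by simp
    also have "\<dots> = (norm w)\<^sup>2 / 2 + inner a b"
      by (simp add: w power2_norm_eq_inner inner_add_left inner_add_right inner_commute field_simps)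
    finally show ?thesis using above[of a b t] that w by simp
  qed
  from prox_point_exists[OF \<open>closed E\<close> \<open>convex E\<close> \<open>E \<noteq> {}\<close> this]
  obtain w t where wt: "(w, t) \<in> E"
    and opt: "\<And>w' t'. (w', t') \<in> E \<Longrightarrow> t - inner w (w' - w) \<le> t'"
    by blast
  obtain a b where w: "w = (a, b)" by fastforce
  have key: "(norm (a + b))\<^sup>2 \<le> inner (- a - u) (- b - v)" if "(v, u) \<in> G" for v u
  proof -
    have "t - inner (a, b) ((v, u) - (a, b)) \<le> inner v u"
      using opt[OF on_graph[OF that]] w by simp
    moreover have "inner a b \<le> t" using above wt w by simp
    ultimately show ?thesis
      by (simp add: power2_norm_eq_inner inner_add_left inner_add_right inner_diff_left
          inner_diff_right inner_commute)
  qed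
  have "(- b, - a) \<in> G"
    by (rule maximal) (use key in \<open>meson order_trans zero_le_power2\<close>)
  moreover from key[OF this] have "- a = b"
    by (simp add: add_eq_0_iff)
  ultimately show thesis using that[of "- b"] by simp
qed

text \<open>Maximality among operators in pointwise form: adjoining a monotonically related pair to the
  graph gives a monotone extension.\<close>

lemma maximally_monotoneD:
  assumes "maximally_monotone A"
    and "\<And>y v. v \<in> A y \<Longrightarrow> 0 \<le> inner (u - v) (x - y)"
  shows "u \<in> A x"
proof -
  define B where "B = A(x := insert u (A x))"
  have mono: "0 \<le> inner (u - v) (x - y)" if "u \<in> A x" "v \<in> A y" for x u y v
    using assms(1) that by (auto simp: maximally_monotone_def monotone_operator_def)
  have sym: "0 \<le> inner (v - u) (y - x)" if "v \<in> A y" for y v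
    using assms(2)[OF that] by (metis inner_minus_left inner_minus_right minus_diff_eq minus_minus)
  have "monotone_operator B"
    using mono assms(2) sym by (auto simp: monotone_operator_def B_def split: if_splits)
  moreover have "\<forall>x. A x \<subseteq> B x" by (auto simp: B_def)
  ultimately have "B = A" using assms(1) by (auto simp: maximally_monotone_def)
  then show ?thesis by (metis B_def fun_upd_same insertI1)
qed

text \<open>The inclusion \<open>y \<in> p + \<mu> A p\<close> says that \<open>- p\<close> belongs to the value at \<open>p\<close> of the maximally
  monotone operator \<open>v \<mapsto> \<mu> A v - y\<close>, so Minty's theorem solves it; monotonicity makes the solution
  unique, which is what the definite description requires.\<close>

lemma resolvent_inclusion:
  fixes A :: "'a::{real_inner, complete_space} \<Rightarrow> 'a set"
  assumes "maximally_monotone A" and "\<mu> > 0"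
  shows "(y - resolvent A \<mu> y) /\<^sub>R \<mu> \<in> A (resolvent A \<mu> y)"
proof -
  have mono: "0 \<le> inner (u - v) (x - y)" if "u \<in> A x" "v \<in> A y" for x u y v
    using assms(1) that by (auto simp: maximally_monotone_def monotone_operator_def)
  have iff: "p \<in> inverse_operator (id_plus_operator \<mu> A) y \<longleftrightarrow> (y - p) /\<^sub>R \<mu> \<in> A p" for p
  proof
    assume "(y - p) /\<^sub>R \<mu> \<in> A p"
    moreover have "y = p + \<mu> *\<^sub>R ((y - p) /\<^sub>R \<mu>)" using \<open>\<mu> > 0\<close> by simp
    ultimately show "p \<in> inverse_operator (id_plus_operator \<mu> A) y"
      unfolding inverse_operator_def id_plus_operator_def by blast
  next
    assume "p \<in> inverse_operator (id_plus_operator \<mu> A) y"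
    then obtain u where "u \<in> A p" "y = p + \<mu> *\<^sub>R u"
      by (auto simp: inverse_operator_def id_plus_operator_def)
    then show "(y - p) /\<^sub>R \<mu> \<in> A p" using \<open>\<mu> > 0\<close> by simp
  qed
  define G where "G = {(v, \<mu> *\<^sub>R u - y) | v u. u \<in> A v}"
  obtain p where "(p, - p) \<in> G"
  proof (rule minty_graph[of G])
    fix v u v' u' assume "(v, u) \<in> G" "(v', u') \<in> G"
    then obtain c c' where c: "c \<in> A v" "c' \<in> A v'" and "u = \<mu> *\<^sub>R c - y" "u' = \<mu> *\<^sub>R c' - y"
      by (auto simp: G_def)
    then have "u - u' = \<mu> *\<^sub>R (c - c')" by (simp add: scaleR_right_diff_distrib)
    then show "0 \<le> inner (u - u') (v - v')"
      using mono[OF c] \<open>\<mu> > 0\<close> by simp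
  next
    fix v u assume rel: "\<And>v' u'. (v', u') \<in> G \<Longrightarrow> 0 \<le> inner (u - u') (v - v')"
    have "(u + y) /\<^sub>R \<mu> \<in> A v"
    proof (rule maximally_monotoneD[OF assms(1)])
      fix v' c assume "c \<in> A v'"
      then have "0 \<le> inner (u - (\<mu> *\<^sub>R c - y)) (v - v')" by (intro rel) (auto simp: G_def)
      also have "u - (\<mu> *\<^sub>R c - y) = \<mu> *\<^sub>R ((u + y) /\<^sub>R \<mu> - c)"
        using \<open>\<mu> > 0\<close> by (simp add: scaleR_right_diff_distrib)
      finally show "0 \<le> inner ((u + y) /\<^sub>R \<mu> - c) (v - v')"
        using \<open>\<mu> > 0\<close> by (simp add: zero_le_mult_iff)
    qed
    moreover have "u = \<mu> *\<^sub>R ((u + y) /\<^sub>R \<mu>) - y" using \<open>\<mu> > 0\<close> by simp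
    ultimately show "(v, u) \<in> G" unfolding G_def by blast
  qed
  then obtain c where c: "c \<in> A p" "- p = \<mu> *\<^sub>R c - y" by (auto simp: G_def)
  then have "y - p = \<mu> *\<^sub>R c" by (simp add: algebra_simps)
  then have p: "(y - p) /\<^sub>R \<mu> \<in> A p" using c(1) \<open>\<mu> > 0\<close> by simp
  have "q = p" if q: "(y - q) /\<^sub>R \<mu> \<in> A q" for q
  proof -
    have "0 \<le> inner ((y - q) /\<^sub>R \<mu> - (y - p) /\<^sub>R \<mu>) (q - p)" by (rule mono[OF q p])
    also have "(y - q) /\<^sub>R \<mu> - (y - p) /\<^sub>R \<mu> = - ((q - p) /\<^sub>R \<mu>)"
      by (simp add: algebra_simps)
    finally have "inner (q - p) (q - p) \<le> 0"
      using \<open>\<mu> > 0\<close> by (simp add: mult_le_0_iff)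
    then show ?thesis by (metis eq_iff_diff_eq_0 inner_eq_zero_iff inner_ge_zero order_antisym)
  qed
  then have res: "resolvent A \<mu> y = p"
    unfolding resolvent_def iff using p by (rule the_equality[rotated])
  show ?thesis unfolding res by (rule p)
qed

section \<open>Two summability arguments\<close>

lemma summable_of_energy_decay:
  fixes W t :: "nat \<Rightarrow> real"
  assumes "\<And>k. k \<ge> K \<Longrightarrow> W (Suc k) + t k \<le> W k" and "\<And>k. k \<ge> K \<Longrightarrow> 0 \<le> W k"
    and "\<And>k. k \<ge> K \<Longrightarrow> 0 \<le> t k"
  shows "summable t"
proof -
  have "(\<Sum>k<n. t (k + K)) \<le> W K - W (n + K)" for n
  proof (induction n)
    case (Suc n)
    then show ?case using assms(1)[of "n + K"] by simp
  qed simp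
  moreover have "0 \<le> W (n + K)" for n by (simp add: assms(2))
  ultimately have "(\<Sum>k<n. t (k + K)) \<le> W K" for n
    by (smt (verit))
  then have "summable (\<lambda>k. t (k + K))"
    by (intro summableI_nonneg_bounded) (auto simp: assms(3))
  then show ?thesis by (simp add: summable_iff_shift)
qed

text \<open>The two weights are dual: by the inequality \<open>2 c e \<le> k c\<^sup>2 + e\<^sup>2 / k\<close> the increment
  \<open>(g\<^sub>k\<^sub>+\<^sub>1 - g\<^sub>k) (g\<^sub>k\<^sub>+\<^sub>1 + g\<^sub>k)\<close> of \<open>g\<^sup>2\<close> is dominated by summable terms, so \<open>g\<^sup>2\<close> converges. A positive
  limit would make the first series comparable to the harmonic series.\<close>

lemma tendsto_zero_of_weighted_summable:
  fixes g :: "nat \<Rightarrow> real"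
  assumes "\<And>k. 0 \<le> g k"
    and s1: "summable (\<lambda>k. (g k)\<^sup>2 / real k)"
    and s2: "summable (\<lambda>k. real k * (g (Suc k) - g k)\<^sup>2)"
  shows "g \<longlonglongrightarrow> 0"
proof -
  have s1': "summable (\<lambda>k. (g (Suc k))\<^sup>2 / real (Suc k))"
    using s1 by (subst summable_Suc_iff)
  have "summable (\<lambda>k. real k * (g (Suc k) - g k)\<^sup>2 + 2 * ((g k)\<^sup>2 / real k)
      + 4 * ((g (Suc k))\<^sup>2 / real (Suc k)))"
    by (intro summable_add summable_mult s1 s2 s1')
  moreover have "norm ((g (Suc k))\<^sup>2 - (g k)\<^sup>2) \<le> real k * (g (Suc k) - g k)\<^sup>2
      + 2 * ((g k)\<^sup>2 / real k) + 4 * ((g (Suc k))\<^sup>2 / real (Suc k))" if "k \<ge> 1" for k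
  proof -
    define a b where "a = g k" and "b = g (Suc k)"
    have k: "real k > 0" using that by simp
    have "2 * (c * e) \<le> real k * c\<^sup>2 + e\<^sup>2 / real k" for c e :: real
    proof -
      have "0 \<le> (real k * c - e)\<^sup>2 / real k" by simp
      also have "\<dots> = real k * c\<^sup>2 + e\<^sup>2 / real k - 2 * (c * e)"
        using k by (simp add: power2_eq_square field_simps)
      finally show ?thesis by simp
    qed
    from this[of "\<bar>b - a\<bar>" "\<bar>b + a\<bar>"]
    have "2 * \<bar>(b - a) * (b + a)\<bar> \<le> real k * (b - a)\<^sup>2 + (b + a)\<^sup>2 / real k"
      by (simp add: abs_mult)
    moreover have "(b + a)\<^sup>2 / real k \<le> 2 * (a\<^sup>2 / real k) + 4 * (b\<^sup>2 / real (Suc k))"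
    proof -
      have "(b + a)\<^sup>2 \<le> 2 * a\<^sup>2 + 2 * b\<^sup>2"
        using zero_le_power2[of "b - a"] by (simp add: power2_eq_square algebra_simps)
      then have "(b + a)\<^sup>2 / real k \<le> (2 * a\<^sup>2 + 2 * b\<^sup>2) / real k"
        using k by (simp add: divide_right_mono)
      moreover have "b\<^sup>2 / real k \<le> b\<^sup>2 * (2 / real (Suc k))"
      proof -
        have "1 / real k \<le> 2 / real (Suc k)" using that by (simp add: field_simps)
        then have "b\<^sup>2 * (1 / real k) \<le> b\<^sup>2 * (2 / real (Suc k))" by (intro mult_left_mono) auto
        then show ?thesis by simp
      qed
      ultimately show ?thesis by (simp add: add_divide_distrib)
    qed
    moreover have "b\<^sup>2 - a\<^sup>2 = (b - a) * (b + a)" by (simp add: power2_eq_square algebra_simps)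
    moreover have "0 \<le> real k * (b - a)\<^sup>2" "0 \<le> a\<^sup>2 / real k" "0 \<le> b\<^sup>2 / real (Suc k)" by simp_all
    ultimately have "\<bar>b\<^sup>2 - a\<^sup>2\<bar> \<le> real k * (b - a)\<^sup>2 + 2 * (a\<^sup>2 / real k) + 4 * (b\<^sup>2 / real (Suc k))"
      by linarith
    then show ?thesis by (simp add: a_def b_def)
  qed
  ultimately have "summable (\<lambda>k. (g (Suc k))\<^sup>2 - (g k)\<^sup>2)"
    by (rule summable_comparison_test'[where N = 1])
  then have "(\<lambda>n. \<Sum>k<n. (g (Suc k))\<^sup>2 - (g k)\<^sup>2) \<longlonglongrightarrow> (\<Sum>k. (g (Suc k))\<^sup>2 - (g k)\<^sup>2)"
    by (rule summable_LIMSEQ)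
  then have "(\<lambda>n. (g n)\<^sup>2 - (g 0)\<^sup>2) \<longlonglongrightarrow> (\<Sum>k. (g (Suc k))\<^sup>2 - (g k)\<^sup>2)"
    by (simp add: sum_lessThan_telescope[of "\<lambda>k. (g k)\<^sup>2"])
  from tendsto_add[OF this tendsto_const[of "(g 0)\<^sup>2"]]
  obtain L where L: "(\<lambda>n. (g n)\<^sup>2) \<longlonglongrightarrow> L" by auto
  have "L \<ge> 0" by (rule LIMSEQ_le_const[OF L]) auto
  moreover have "\<not> L > 0"
  proof
    assume "L > 0"
    then have "\<forall>\<^sub>F n in sequentially. L / 2 < (g n)\<^sup>2"
      by (intro order_tendstoD(1)[OF L]) simp
    then obtain N where N: "L / 2 < (g n)\<^sup>2" if "n \<ge> N" for n
      by (auto simp: eventually_sequentially)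
    have "summable (\<lambda>k. 1 / real k)"
    proof (rule summable_comparison_test)
      show "summable (\<lambda>k. (2 / L) * ((g k)\<^sup>2 / real k))" by (intro summable_mult s1)
      have "norm (1 / real k) \<le> (2 / L) * ((g k)\<^sup>2 / real k)" if "k \<ge> N" for k
      proof -
        have "1 \<le> (2 / L) * (g k)\<^sup>2" using N[OF that] \<open>L > 0\<close> by (simp add: field_simps)
        then have "1 / real k \<le> (2 / L) * (g k)\<^sup>2 / real k" by (intro divide_right_mono) auto
        then show ?thesis by simp
      qed
      then show "\<exists>N. \<forall>n\<ge>N. norm (1 / real n) \<le> (2 / L) * ((g n)\<^sup>2 / real n)" by blast
    qed
    then show False using not_summable_harmonic[where 'a = real] by (simp add: inverse_eq_divide)
  qed
  ultimately have "(\<lambda>n. sqrt ((g n)\<^sup>2)) \<longlonglongrightarrow> sqrt 0"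
    using tendsto_real_sqrt[OF L] by (metis antisym_conv2)
  then show ?thesis using assms(1) by simp
qed

section \<open>The energy of the inertial iteration\<close>

text \<open>Here \<open>a\<close> and \<open>b\<close> are the consecutive iterates \<open>x\<^sub>k\<^sub>-\<^sub>1\<close> and \<open>x\<^sub>k\<close>, \<open>z\<close> is the anchor and \<open>c\<close> stands
  for \<open>1 + \<epsilon>\<close>. With \<open>h\<^sub>k = \<parallel>x\<^sub>k - z\<parallel>\<^sup>2 / 2\<close> the first two terms are
  \<open>(k - 1) (h\<^sub>k - h\<^sub>k\<^sub>-\<^sub>1) + (\<alpha> - 1) h\<^sub>k\<^sub>-\<^sub>1\<close>, whose increment is \<open>k\<close> times
  \<open>(h\<^sub>k\<^sub>+\<^sub>1 - h\<^sub>k) - (1 - \<alpha> / k) (h\<^sub>k - h\<^sub>k\<^sub>-\<^sub>1)\<close>, the expression in which the inertial extrapolation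
  appears.\<close>

definition energy :: "real \<Rightarrow> real \<Rightarrow> 'a::real_inner \<Rightarrow> real \<Rightarrow> 'a \<Rightarrow> 'a \<Rightarrow> real" where
  "energy \<alpha> c z k a b =
     (k - 1) * (((norm (b - z))\<^sup>2 - (norm (a - z))\<^sup>2) / 2) + (\<alpha> - 1) * ((norm (a - z))\<^sup>2 / 2)
     + c / \<alpha> * (k - 1)\<^sup>2 * (norm (b - a))\<^sup>2"

text \<open>Once \<open>\<parallel>b - z\<parallel>\<^sup>2\<close> is expanded around \<open>a\<close>, only the summand \<open>(k - 1) \<langle>b - a, a - z\<rangle>\<close> can be
  negative. Completing the square absorbs it into \<open>(k - 1)\<^sup>2 \<parallel>b - a\<parallel>\<^sup>2 / \<alpha>\<close> and \<open>(\<alpha> / 4) \<parallel>a - z\<parallel>\<^sup>2\<close>, and \<open>\<alpha> / 4 \<le> (\<alpha> - 1) / 2\<close> because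
  \<open>\<alpha> > 2\<close>.\<close>

lemma energy_nonneg:
  fixes a b z :: "'a::real_inner"
  assumes "k \<ge> 1" and "\<alpha> > 2" and "c \<ge> 1"
  shows "0 \<le> energy \<alpha> c z k a b"
proof -
  define X P H where "X = (norm (b - a))\<^sup>2" and "P = inner (b - a) (a - z)" and "H = (norm (a - z))\<^sup>2"
  have square: "(norm (m *\<^sub>R f + h))\<^sup>2 = m\<^sup>2 * (norm f)\<^sup>2 + 2 * m * inner f h + (norm h)\<^sup>2"
    for m and f h :: 'a
    unfolding power2_norm_eq_inner inner_add_left inner_add_right
    by (simp add: inner_commute power2_eq_square[of m])
  have e: "energy \<alpha> c z k a b = (k - 1) * (P + X / 2) + (\<alpha> - 1) * (H / 2) + c / \<alpha> * ((k - 1)\<^sup>2 * X)"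
  proof -
    have "(norm (b - z))\<^sup>2 = X + 2 * P + H"
      using square[of 1 "b - a" "a - z"] by (simp add: X_def P_def H_def)
    then show ?thesis by (simp add: energy_def X_def[symmetric] H_def[symmetric] field_simps)
  qed
  have nn: "X \<ge> 0" "H \<ge> 0" by (simp_all add: X_def H_def)
  have "0 \<le> \<alpha> / 4 * (norm ((2 * (k - 1) / \<alpha>) *\<^sub>R (b - a) + (a - z)))\<^sup>2" using assms by simp
  also have "\<dots> = \<alpha> / 4 * ((2 * (k - 1) / \<alpha>)\<^sup>2 * X + 2 * (2 * (k - 1) / \<alpha>) * P + H)"
    unfolding X_def P_def H_def square by simp
  also have "\<dots> = (k - 1)\<^sup>2 * X / \<alpha> + (k - 1) * P + \<alpha> / 4 * H"
    using assms by (simp add: power2_eq_square field_simps)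
  finally have 1: "0 \<le> (k - 1)\<^sup>2 * X / \<alpha> + (k - 1) * P + \<alpha> / 4 * H" .
  have 2: "\<alpha> / 4 * H \<le> (\<alpha> - 1) * (H / 2)"
    using mult_right_mono[of "\<alpha> / 4" "(\<alpha> - 1) / 2" H] assms nn by simp
  have 3: "(k - 1)\<^sup>2 * X / \<alpha> \<le> c / \<alpha> * ((k - 1)\<^sup>2 * X)"
    using mult_right_mono[of 1 c "(k - 1)\<^sup>2 * X / \<alpha>"] assms nn by simp
  have 4: "0 \<le> (k - 1) * (X / 2)" using assms nn by simp
  show ?thesis using 1 2 3 4 unfolding e distrib_left by linarith
qed

text \<open>The equation \<open>res\<close> turns \<open>growth\<close> into a lower bound for \<open>\<langle>\<xi>, b' - z\<rangle>\<close> with the extra term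
  \<open>\<lambda> \<parallel>\<xi>\<parallel>\<^sup>2\<close>, where \<open>\<lambda> = c s k\<^sup>2 / \<alpha>\<^sup>2\<close>, and \<open>step\<close> expresses \<open>s \<xi>\<close> through the velocities
  \<open>d = b - a\<close> and \<open>e = b' - b\<close>. Both sides are then polynomials in \<open>k\<close> and in inner products. The
  products with \<open>b - z\<close> cancel; writing \<open>2 \<langle>d, e\<rangle> = \<parallel>d\<parallel>\<^sup>2 + \<parallel>e\<parallel>\<^sup>2 - \<parallel>e - d\<parallel>\<^sup>2\<close> leaves a combination of
  three squares, whose coefficients have the right sign once \<open>k \<ge> 2 \<alpha>\<close>.\<close>

lemma energy_step:
  fixes a b b' p \<xi> z :: "'a::real_inner"
  assumes "\<alpha> > 2" and "k \<ge> 2 * \<alpha>" and "c \<ge> 1" and "s > 0"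
    and step: "b' = b + (1 - \<alpha> / k) *\<^sub>R (b - a) - s *\<^sub>R \<xi>"
    and res: "b' = p + (c * (s * k\<^sup>2 / \<alpha>\<^sup>2)) *\<^sub>R \<xi>"
    and growth: "\<beta> \<le> inner \<xi> (p - z)"
  shows "energy \<alpha> c z (k + 1) b b' + ((c - 1 - 2 * c / \<alpha>) * (k * (norm (b - a))\<^sup>2)
      + c / (2 * \<alpha>\<^sup>2) * (k ^ 3 * (norm ((b' - b) - (b - a)))\<^sup>2) + s * (k * \<beta>))
    \<le> energy \<alpha> c z k a b"
proof -
  define d e r where "d = b - a" and "e = b' - b" and "r = b - z"
  define X Y Z P Q N where "X = inner d d" and "Y = inner d e" and "Z = inner e e"
    and "P = inner d r" and "Q = inner e r" and "N = inner (e - d) (e - d)"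
  define t where "t = 1 - \<alpha> / k"
  have k: "k > 0" "\<alpha> > 0" using assms by auto
  have ka: "k * t = k - \<alpha>" using k by (simp add: t_def field_simps)
  have nn: "X \<ge> 0" "Z \<ge> 0" "N \<ge> 0" by (simp_all add: X_def Z_def N_def)
  have Y: "Y = (X + Z - N) / 2"
    by (simp add: X_def Y_def Z_def N_def inner_diff_left inner_diff_right inner_commute)
  have sxi: "s *\<^sub>R \<xi> = t *\<^sub>R d - e" using step by (simp add: t_def d_def e_def)
  have p: "p - z = r + e - (c * (s * k\<^sup>2 / \<alpha>\<^sup>2)) *\<^sub>R \<xi>" using res by (simp add: r_def e_def)
  have "s * inner \<xi> (p - z) = inner (s *\<^sub>R \<xi>) (r + e) - c * k\<^sup>2 / \<alpha>\<^sup>2 * inner (s *\<^sub>R \<xi>) (s *\<^sub>R \<xi>)"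
    unfolding p by (simp add: inner_diff_right algebra_simps)
  also have "\<dots> = t * P + t * Y - Q - Z - c * k\<^sup>2 / \<alpha>\<^sup>2 * (t\<^sup>2 * X - 2 * t * Y + Z)"
    unfolding sxi X_def Y_def Z_def P_def Q_def
    by (simp add: inner_diff_left inner_diff_right inner_add_right inner_commute power2_eq_square
        algebra_simps)
  finally have "s * \<beta> \<le> t * P + t * Y - Q - Z - c * k\<^sup>2 / \<alpha>\<^sup>2 * (t\<^sup>2 * X - 2 * t * Y + Z)"
    using growth \<open>s > 0\<close> by (metis mult_left_mono less_imp_le)
  then have "k * (s * \<beta>) \<le> k * (t * P + t * Y - Q - Z - c * k\<^sup>2 / \<alpha>\<^sup>2 * (t\<^sup>2 * X - 2 * t * Y + Z))"
    using k by (intro mult_left_mono) auto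
  also have "\<dots> = (k * t) * P + (k * t) * Y - k * Q - k * Z
      - c / \<alpha>\<^sup>2 * (k * ((k * t)\<^sup>2 * X - 2 * k * (k * t) * Y + k\<^sup>2 * Z))"
    by (simp add: power2_eq_square algebra_simps add_divide_distrib)
  finally have \<beta>: "s * (k * \<beta>) \<le> (k - \<alpha>) * P + (k - \<alpha>) * Y - k * Q - k * Z
      - c / \<alpha>\<^sup>2 * (k * ((k - \<alpha>)\<^sup>2 * X - 2 * k * (k - \<alpha>) * Y + k\<^sup>2 * Z))"
    unfolding ka by (simp add: mult_ac)
  have E0: "energy \<alpha> c z k a b
      = (k - 1) * (P - X / 2) + (\<alpha> - 1) * ((inner r r - 2 * P + X) / 2) + c / \<alpha> * (k - 1)\<^sup>2 * X"
  proof -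
    have "a - z = r - d" by (simp add: r_def d_def)
    then have sq: "inner (a - z) (a - z) = inner r r - 2 * P + X"
      by (simp add: X_def P_def inner_diff_left inner_diff_right inner_commute)
    show ?thesis
      unfolding energy_def d_def[symmetric] r_def[symmetric] power2_norm_eq_inner X_def[symmetric] sq
      by (simp add: field_simps)
  qed
  have E1: "energy \<alpha> c z (k + 1) b b'
      = k * (Q + Z / 2) + (\<alpha> - 1) * (inner r r / 2) + c / \<alpha> * k\<^sup>2 * Z"
  proof -
    have "b' - z = r + e" by (simp add: r_def e_def)
    then have sq: "inner (b' - z) (b' - z) = inner r r + 2 * Q + Z"
      by (simp add: Z_def Q_def inner_add_left inner_add_right inner_commute)
    show ?thesis
      unfolding energy_def e_def[symmetric] r_def[symmetric] power2_norm_eq_inner Z_def[symmetric] sq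
      by (simp add: field_simps)
  qed
  have "energy \<alpha> c z (k + 1) b b' + (c - 1 - 2 * c / \<alpha>) * (k * X) + c / (2 * \<alpha>\<^sup>2) * (k ^ 3 * N)
      + ((k - \<alpha>) * P + (k - \<alpha>) * Y - k * Q - k * Z
      - c / \<alpha>\<^sup>2 * (k * ((k - \<alpha>)\<^sup>2 * X - 2 * k * (k - \<alpha>) * Y + k\<^sup>2 * Z)))
    = energy \<alpha> c z k a b - ((\<alpha> + c / \<alpha>) * X + \<alpha> / 2 * Z
        + ((k - \<alpha>) / 2 + c / \<alpha>\<^sup>2 * k\<^sup>2 * (k / 2 - \<alpha>)) * N)"
  proof -
    \<comment> \<open>The substitution clears \<open>\<alpha>\<close> from the denominators, so that only a polynomial identity is left.\<close>
    define w where "w = c / \<alpha>\<^sup>2"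
    have w: "c / \<alpha> = w * \<alpha>" "2 * c / \<alpha> = 2 * w * \<alpha>" "c / (2 * \<alpha>\<^sup>2) = w / 2" "c = w * \<alpha>\<^sup>2"
      using k by (simp_all add: w_def power2_eq_square)
    have N: "N = X + Z - 2 * Y" using Y by simp
    show ?thesis
      unfolding E0 E1 N w_def[symmetric] w(1-3)
      by (subst w(4)) (simp add: field_simps power2_eq_square power3_eq_cube)
  qed
  moreover have "0 \<le> (\<alpha> + c / \<alpha>) * X + \<alpha> / 2 * Z
        + ((k - \<alpha>) / 2 + c / \<alpha>\<^sup>2 * k\<^sup>2 * (k / 2 - \<alpha>)) * N"
    using assms k nn by (intro add_nonneg_nonneg mult_nonneg_nonneg) auto
  ultimately show ?thesis
    using \<beta> unfolding power2_norm_eq_inner d_def[symmetric] e_def[symmetric] X_def[symmetric] N_def[symmetric]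
    by linarith
qed

section \<open>Convergence of the regularised inertial proximal algorithm\<close>

theorem theorem5p2:
  fixes A :: "'a::{real_inner, complete_space} \<Rightarrow> 'a set"
    and S :: "'a set"
    and \<nu> s \<alpha> \<epsilon> :: real
    and lam :: "nat \<Rightarrow> real"
    and x y :: "nat \<Rightarrow> 'a"
  assumes "maximally_monotone A"
    and "S = inverse_operator A 0"
    and "S \<noteq> {}"
    and "\<nu> > 0"
    and "\<And>w u z. u \<in> A w \<Longrightarrow> z \<in> S \<Longrightarrow> inner u (w - z) \<ge> \<nu> * (infdist w S)\<^sup>2"
    and "s > 0"
    and "\<alpha> > 2"
    and "\<epsilon> > 2 / (\<alpha> - 2)"
    and "\<And>k. k \<ge> 1 \<Longrightarrow> lam k = (1 + \<epsilon>) * (s * (real k)\<^sup>2 / \<alpha>\<^sup>2)"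
    and "\<And>k. k \<ge> 1 \<Longrightarrow> y k = x k + (1 - \<alpha> / real k) *\<^sub>R (x k - x (k - 1))"
    and "\<And>k. k \<ge> 1 \<Longrightarrow>
           x (k + 1) = (lam k / (lam k + s)) *\<^sub>R y k
             + (s / (lam k + s)) *\<^sub>R resolvent A (lam k + s) (y k)"
  shows "((\<lambda>k. infdist (x k) S) \<longlonglongrightarrow> 0) \<and>
         (\<forall>zbar. S = {zbar} \<longrightarrow> x \<longlonglongrightarrow> zbar)"
proof -
  define c where "c = 1 + \<epsilon>"
  define d where "d k = x k - x (k - 1)" for k
  define p where "p k = resolvent A (lam k + s) (y k)" for k
  define \<xi> where "\<xi> k = (y k - p k) /\<^sub>R (lam k + s)" for k
  define D where "D k = infdist (p k) S" for k
  have "\<epsilon> > 0" using \<open>\<epsilon> > 2 / (\<alpha> - 2)\<close> \<open>\<alpha> > 2\<close>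
    by (meson diff_gt_0_iff_gt divide_pos_pos less_trans zero_less_numeral)
  then have "c \<ge> 1" by (simp add: c_def)
  have \<delta>: "c - 1 - 2 * c / \<alpha> > 0"
    using \<open>\<epsilon> > 2 / (\<alpha> - 2)\<close> \<open>\<alpha> > 2\<close> by (simp add: c_def field_simps)
  obtain z where "z \<in> S" using \<open>S \<noteq> {}\<close> by blast
  have lam: "lam k = c * (s * (real k)\<^sup>2 / \<alpha>\<^sup>2)" if "k \<ge> 1" for k
    using assms(9)[OF that] by (simp add: c_def)
  have lam_nonneg: "lam k \<ge> 0" if "k \<ge> 1" for k
    using \<open>c \<ge> 1\<close> \<open>s > 0\<close> by (simp add: lam[OF that])
  have x_eq: "x (Suc k) = y k - s *\<^sub>R \<xi> k" "x (Suc k) = p k + lam k *\<^sub>R \<xi> k" if "k \<ge> 1" for k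
  proof -
    have pos: "lam k + s > 0" using lam_nonneg[OF that] \<open>s > 0\<close> by simp
    have yp: "y k = p k + (lam k + s) *\<^sub>R \<xi> k" using pos by (simp add: \<xi>_def)
    have "x (Suc k) = (lam k / (lam k + s)) *\<^sub>R y k + (s / (lam k + s)) *\<^sub>R p k"
      using assms(11)[OF that] by (simp add: p_def)
    also have "\<dots> = (lam k / (lam k + s) + s / (lam k + s)) *\<^sub>R p k + lam k *\<^sub>R \<xi> k"
    proof -
      have "(lam k / (lam k + s)) *\<^sub>R y k = (lam k / (lam k + s)) *\<^sub>R p k + lam k *\<^sub>R \<xi> k"
        unfolding yp scaleR_add_right using pos by simp
      then show ?thesis by (simp add: scaleR_add_left)
    qed
    also have "lam k / (lam k + s) + s / (lam k + s) = 1"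
      using pos by (simp add: add_divide_distrib[symmetric])
    finally show 2: "x (Suc k) = p k + lam k *\<^sub>R \<xi> k" by simp
    then show "x (Suc k) = y k - s *\<^sub>R \<xi> k" by (simp add: yp algebra_simps)
  qed
  have growth: "\<nu> * (D k)\<^sup>2 \<le> inner (\<xi> k) (p k - z)" if "k \<ge> 1" for k
  proof -
    have "lam k + s > 0" using lam_nonneg[OF that] \<open>s > 0\<close> by simp
    then have "\<xi> k \<in> A (p k)"
      unfolding \<xi>_def p_def by (rule resolvent_inclusion[OF \<open>maximally_monotone A\<close>])
    then show ?thesis unfolding D_def by (rule assms(5)) (rule \<open>z \<in> S\<close>)
  qed
  \<comment> \<open>From this index on the energy decreases.\<close>
  define K where "K = nat \<lceil>2 * \<alpha>\<rceil>"
  have K: "real k \<ge> 2 * \<alpha>" "k \<ge> 1" if "k \<ge> K" for k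
  proof -
    show "real k \<ge> 2 * \<alpha>" using that unfolding K_def by linarith
    then show "k \<ge> 1" using \<open>\<alpha> > 2\<close> by (cases k) auto
  qed
  define T where "T k = (c - 1 - 2 * c / \<alpha>) * (real k * (norm (d k))\<^sup>2)
    + c / (2 * \<alpha>\<^sup>2) * (real k ^ 3 * (norm (d (Suc k) - d k))\<^sup>2) + s * (real k * (\<nu> * (D k)\<^sup>2))" for k
  have parts: "0 \<le> (c - 1 - 2 * c / \<alpha>) * (real k * (norm (d k))\<^sup>2)"
    "0 \<le> c / (2 * \<alpha>\<^sup>2) * (real k ^ 3 * (norm (d (Suc k) - d k))\<^sup>2)"
    "0 \<le> s * (real k * (\<nu> * (D k)\<^sup>2))" for k
    using \<delta> \<open>c \<ge> 1\<close> \<open>s > 0\<close> \<open>\<nu> > 0\<close> by simp_all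
  have "summable T"
  proof (rule summable_of_energy_decay)
    fix k assume "k \<ge> K"
    note k = K[OF this]
    show "energy \<alpha> c z (real (Suc k)) (x (Suc k - 1)) (x (Suc k)) + T k
        \<le> energy \<alpha> c z (real k) (x (k - 1)) (x k)"
    proof -
      have "x (Suc k) = x k + (1 - \<alpha> / real k) *\<^sub>R (x k - x (k - 1)) - s *\<^sub>R \<xi> k"
        using x_eq(1)[OF k(2)] assms(10)[OF k(2)] by simp
      moreover have "x (Suc k) = p k + (c * (s * (real k)\<^sup>2 / \<alpha>\<^sup>2)) *\<^sub>R \<xi> k"
        using x_eq(2)[OF k(2)] lam[OF k(2)] by simp
      ultimately have "energy \<alpha> c z (real k + 1) (x k) (x (Suc k))
          + ((c - 1 - 2 * c / \<alpha>) * (real k * (norm (x k - x (k - 1)))\<^sup>2)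
          + c / (2 * \<alpha>\<^sup>2) * (real k ^ 3 * (norm ((x (Suc k) - x k) - (x k - x (k - 1))))\<^sup>2)
          + s * (real k * (\<nu> * (D k)\<^sup>2)))
        \<le> energy \<alpha> c z (real k) (x (k - 1)) (x k)"
        using growth[OF k(2)] by (rule energy_step[OF \<open>\<alpha> > 2\<close> k(1) \<open>c \<ge> 1\<close> \<open>s > 0\<close>])
      then show ?thesis by (simp add: T_def d_def add.commute)
    qed
    show "0 \<le> energy \<alpha> c z (real k) (x (k - 1)) (x k)"
      using k \<open>\<alpha> > 2\<close> \<open>c \<ge> 1\<close> by (intro energy_nonneg) auto
    show "0 \<le> T k" unfolding T_def using parts[of k] by linarith
  qed
  have part: "summable f" if "q > 0" "\<And>k. 0 \<le> f k" "\<And>k. q * f k \<le> T k" for f :: "nat \<Rightarrow> real" and q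
  proof -
    have "summable (\<lambda>k. q * f k)"
      using that by (intro summable_comparison_test'[OF \<open>summable T\<close>]) auto
    then show ?thesis using \<open>q > 0\<close> by (simp add: summable_mult_D)
  qed
  have sum_d: "summable (\<lambda>k. real k * (norm (d k))\<^sup>2)"
    by (rule part[OF \<delta>]) (use parts in \<open>auto simp: T_def intro: add_increasing2\<close>)
  have sum_dd: "summable (\<lambda>k. real k ^ 3 * (norm (d (Suc k) - d k))\<^sup>2)"
  proof (rule part[of "c / (2 * \<alpha>\<^sup>2)"])
    show "c / (2 * \<alpha>\<^sup>2) > 0" using \<open>c \<ge> 1\<close> \<open>\<alpha> > 2\<close> by simp
    show "c / (2 * \<alpha>\<^sup>2) * (real k ^ 3 * (norm (d (Suc k) - d k))\<^sup>2) \<le> T k" for k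
      unfolding T_def using parts[of k] by linarith
  qed simp
  have sum_D: "summable (\<lambda>k. real k * (D k)\<^sup>2)"
  proof (rule part[of "s * \<nu>"])
    show "s * \<nu> > 0" using \<open>s > 0\<close> \<open>\<nu> > 0\<close> by simp
    show "s * \<nu> * (real k * (D k)\<^sup>2) \<le> T k" for k
      unfolding T_def using parts[of k] by (simp add: mult_ac)
  qed simp
  \<comment> \<open>The index is shifted because the step \<open>k\<close> estimates the distance of \<open>x\<^sub>k\<^sub>+\<^sub>1\<close>.\<close>
  define g where "g k = infdist (x (Suc k)) S" for k
  define M where "M = (c / \<alpha>\<^sup>2)\<^sup>2"
  have "g \<longlonglongrightarrow> 0"
  proof (rule tendsto_zero_of_weighted_summable)
    show "0 \<le> g k" for k by (simp add: g_def infdist_nonneg)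
    have "summable (\<lambda>k. 2 * (real k * (D k)\<^sup>2)
        + 4 * M * (real k ^ 3 * (norm (d (Suc k) - d k))\<^sup>2 + \<alpha>\<^sup>2 * (real k * (norm (d k))\<^sup>2)))"
      by (intro summable_add summable_mult sum_d sum_dd sum_D)
    moreover have "norm ((g k)\<^sup>2 / real k) \<le> 2 * (real k * (D k)\<^sup>2)
        + 4 * M * (real k ^ 3 * (norm (d (Suc k) - d k))\<^sup>2 + \<alpha>\<^sup>2 * (real k * (norm (d k))\<^sup>2))"
      if k: "k \<ge> 1" for k
    proof -
      define u where "u = norm (d (Suc k) - d k)"
      define v where "v = \<alpha> / real k * norm (d k)"
      have sq: "(a + b)\<^sup>2 \<le> 2 * a\<^sup>2 + 2 * b\<^sup>2" for a b :: real
        using zero_le_power2[of "a - b"] by (simp add: power2_eq_square algebra_simps)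
      have "s *\<^sub>R \<xi> k = - ((d (Suc k) - d k) + (\<alpha> / real k) *\<^sub>R d k)"
        using x_eq(1)[OF k] assms(10)[OF k] by (simp add: d_def algebra_simps)
      then have "norm (s *\<^sub>R \<xi> k) = norm ((d (Suc k) - d k) + (\<alpha> / real k) *\<^sub>R d k)"
        by (simp only: norm_minus_cancel)
      then have "norm (s *\<^sub>R \<xi> k) \<le> u + v"
        using norm_triangle_ineq[of "d (Suc k) - d k" "(\<alpha> / real k) *\<^sub>R d k"] \<open>\<alpha> > 2\<close>
        by (simp add: u_def v_def)
      then have s\<xi>: "s * norm (\<xi> k) \<le> u + v" using \<open>s > 0\<close> by simp
      have "dist (x (Suc k)) (p k) = c / \<alpha>\<^sup>2 * (real k)\<^sup>2 * (s * norm (\<xi> k))"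
      proof -
        have "dist (x (Suc k)) (p k) = lam k * norm (\<xi> k)"
          using x_eq(2)[OF k] lam_nonneg[OF k] by (simp add: dist_norm)
        then show ?thesis by (simp add: lam[OF k])
      qed
      also have "\<dots> \<le> c / \<alpha>\<^sup>2 * (real k)\<^sup>2 * (u + v)"
        using s\<xi> \<open>c \<ge> 1\<close> by (intro mult_left_mono) auto
      finally have "g k \<le> D k + c / \<alpha>\<^sup>2 * (real k)\<^sup>2 * (u + v)"
        using infdist_triangle[of "x (Suc k)" S "p k"] by (simp add: g_def D_def)
      then have "(g k)\<^sup>2 \<le> (D k + c / \<alpha>\<^sup>2 * (real k)\<^sup>2 * (u + v))\<^sup>2"
        by (intro power_mono) (auto simp: g_def infdist_nonneg)
      also have "\<dots> \<le> 2 * (D k)\<^sup>2 + 2 * (c / \<alpha>\<^sup>2 * (real k)\<^sup>2 * (u + v))\<^sup>2" by (rule sq)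
      also have "(c / \<alpha>\<^sup>2 * (real k)\<^sup>2 * (u + v))\<^sup>2 = M * real k ^ 4 * (u + v)\<^sup>2"
        by (simp add: M_def field_simps power2_eq_square power4_eq_xxxx)
      also have "\<dots> \<le> M * real k ^ 4 * (2 * u\<^sup>2 + 2 * v\<^sup>2)"
        by (intro mult_left_mono sq) (simp add: M_def)
      finally have "(g k)\<^sup>2 / real k \<le> (2 * (D k)\<^sup>2 + 2 * (M * real k ^ 4 * (2 * u\<^sup>2 + 2 * v\<^sup>2))) / real k"
        by (simp add: divide_right_mono)
      also have "\<dots> = 2 * ((D k)\<^sup>2 / real k)
          + 4 * M * (real k ^ 3 * u\<^sup>2 + \<alpha>\<^sup>2 * (real k * (norm (d k))\<^sup>2))"
        using k by (simp add: v_def field_simps power2_eq_square power3_eq_cube power4_eq_xxxx)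
      also have "(D k)\<^sup>2 / real k \<le> real k * (D k)\<^sup>2"
      proof -
        have "1 / real k \<le> 1" "1 \<le> real k" using k by simp_all
        then have "1 / real k \<le> real k" by linarith
        then have "(D k)\<^sup>2 * (1 / real k) \<le> (D k)\<^sup>2 * real k" by (intro mult_left_mono) auto
        then show ?thesis by (simp add: mult.commute)
      qed
      finally show ?thesis by (simp add: u_def)
    qed
    ultimately show "summable (\<lambda>k. (g k)\<^sup>2 / real k)"
      by (rule summable_comparison_test'[where N = 1])
    have "summable (\<lambda>k. real (Suc (Suc k)) * (norm (d (Suc (Suc k))))\<^sup>2)"
      using sum_d summable_iff_shift[of "\<lambda>k. real k * (norm (d k))\<^sup>2" 2] by simp
    moreover have "norm (real k * (g (Suc k) - g k)\<^sup>2) \<le> real (Suc (Suc k)) * (norm (d (Suc (Suc k))))\<^sup>2" for k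
    proof -
      have "\<bar>g (Suc k) - g k\<bar> \<le> norm (d (Suc (Suc k)))"
        using infdist_triangle_abs[of "x (Suc (Suc k))" S "x (Suc k)"]
        by (simp add: g_def d_def dist_norm)
      then have "(g (Suc k) - g k)\<^sup>2 \<le> (norm (d (Suc (Suc k))))\<^sup>2"
        by (simp add: abs_le_square_iff[symmetric])
      then show ?thesis by (simp add: mult_mono)
    qed
    ultimately show "summable (\<lambda>k. real k * (g (Suc k) - g k)\<^sup>2)"
      by (rule summable_comparison_test'[where N = 0])
  qed
  then have lim: "(\<lambda>k. infdist (x k) S) \<longlonglongrightarrow> 0"
    unfolding g_def by (rule LIMSEQ_imp_Suc)
  moreover have "x \<longlonglongrightarrow> zbar" if "S = {zbar}" for zbar
    using lim unfolding that infdist_singleton by (subst tendsto_dist_iff)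
  ultimately show ?thesis by blast
qed

end
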